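(* For all integers $k\geq 1$ and $n\geq 1$, the number $D_k(n)$ of $k$-omino towers with area $kn$ (i.e. consisting of exactly $n$ blocks, with any base length $b$, $1\le b\le n$) is \[ D_k(n)=\binom{kn-1}{n-1}\,{}_2F_1\bigl(1,\,1-n;\,(k-1)n+1;\,-1\bigr), \] where ${}_2F_1(a,b;c;z)=\sum_{m\ge 0}\frac{(a)_m(b)_m}{(c)_m}\frac{z^m}{m!}$ is the Gauss hypergeometric function and $(x)_0=1$, $(x)_m=x(x+1)\cdots(x+m-1)$.
   Context: Fix an integer $k\ge1$. A $k$-omino block is a horizontal $k\times 1$ rectangle of unit squares occupying cells $(x,y),(x+1,y),\dots,(x+k-1,y)$ of the integer grid; $y$ is its level and $\{x,\dots,x+k-1\}$ its column set. For integers $n\ge b\ge1$, an $(n,b)$-$k$-omino tower is a finite set of $n$ pairwise non-overlapping horizontal $k$-omino blocks such that: (i) exactly $b$ of them (the base) lie at level $0$ and they occupy a contiguous horizontal run of $bk$ cells; (ii) the other $n-b$ blocks lie at levels $\ge1$, and every such block at columns $\{x,\dots,x+k-1\}$ and level $y$ has some block at level $y-1$ whose column set intersects $\{x,\dots,x+k-1\}$ (equivalently, some block occupies one of the $2k-1$ positions from $\{x-k+1,\dots,x\}$ to $\{x+k-1,\dots,x+2k-2\}$ at level $y-1$). Towers are fixed polyominoes, i.e. two towers are the same if one is a horizontal translate of the other. A $k$-omino tower of area $kn$ is an $(n,b)$-$k$-omino tower for some $1\le b\le n$. *)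

theory Defs
  imports Complex_Main "HOL-Library.Disjoint_Sets"
begin

text \<open>A block is given by the coordinates (column, level) of its leftmost cell; its length
  \<open>k\<close> is a separate parameter.\<close>

type_synonym block = "int \<times> int"

definition level :: "block \<Rightarrow> int" where
  "level B = snd B"

definition columns :: "nat \<Rightarrow> block \<Rightarrow> int set" where
  "columns k B = {fst B ..< fst B + int k}"

definition cells :: "nat \<Rightarrow> block \<Rightarrow> (int \<times> int) set" where
  "cells k B = columns k B \<times> {level B}"

definition base :: "block set \<Rightarrow> block set" where
  "base T = {B \<in> T. level B = 0}"

definition omino_tower :: "nat \<Rightarrow> nat \<Rightarrow> nat \<Rightarrow> block set \<Rightarrow> bool" where
  "omino_tower k n b T \<longleftrightarrow>
     finite T \<and> card T = n \<and>
     disjoint_family_on (cells k) T \<and>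
     card (base T) = b \<and>
     (\<exists>x. (\<Union>B\<in>base T. columns k B) = {x ..< x + int (b * k)}) \<and>
     (\<forall>B\<in>T - base T. level B \<ge> 1 \<and>
        (\<exists>C\<in>T. level C = level B - 1 \<and> columns k C \<inter> columns k B \<noteq> {}))"

definition towers_of_area :: "nat \<Rightarrow> nat \<Rightarrow> block set set" where
  "towers_of_area k n = {T. \<exists>b. 1 \<le> b \<and> b \<le> n \<and> omino_tower k n b T}"

definition htranslate :: "int \<Rightarrow> block set \<Rightarrow> block set" where
  "htranslate d T = (\<lambda>(x, y). (x + d, y)) ` T"

definition htranslate_rel :: "nat \<Rightarrow> nat \<Rightarrow> (block set \<times> block set) set" where
  "htranslate_rel k n =
     {(S, T). S \<in> towers_of_area k n \<and> T \<in> towers_of_area k n \<and> (\<exists>d. T = htranslate d S)}"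

lemma equiv_htranslate_rel: "equiv (towers_of_area k n) (htranslate_rel k n)"
proof (rule equivI)
  have 0: "htranslate 0 T = T" for T
    by (force simp: htranslate_def)
  have add: "htranslate d (htranslate e T) = htranslate (e + d) T" for d e T
    by (force simp: htranslate_def image_image case_prod_unfold algebra_simps)
  show "htranslate_rel k n \<subseteq> towers_of_area k n \<times> towers_of_area k n"
    by (auto simp: htranslate_rel_def)
  show "refl_on (towers_of_area k n) (htranslate_rel k n)"
    by (auto simp: refl_on_def htranslate_rel_def intro: exI[of _ 0] simp: 0)
  show "sym (htranslate_rel k n)"
  proof (rule symI)
    fix S T assume "(S, T) \<in> htranslate_rel k n"
    then obtain d where st: "S \<in> towers_of_area k n" "T \<in> towers_of_area k n"
      and d: "T = htranslate d S"
      by (auto simp: htranslate_rel_def)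
    have "S = htranslate (- d) T"
      by (simp add: d add 0)
    with st show "(T, S) \<in> htranslate_rel k n"
      by (auto simp: htranslate_rel_def)
  qed
  show "trans (htranslate_rel k n)"
    by (rule transI) (auto simp: htranslate_rel_def add)
qed

definition num_towers :: "nat \<Rightarrow> nat \<Rightarrow> nat" where
  "num_towers k n = card (towers_of_area k n // htranslate_rel k n)"

definition gauss_2F1 :: "real \<Rightarrow> real \<Rightarrow> real \<Rightarrow> real \<Rightarrow> real" where
  "gauss_2F1 a b c z =
     (\<Sum>m. pochhammer a m * pochhammer b m / pochhammer c m * (z ^ m / fact m))"

end

theory Submission
  imports Defs
begin

text \<open>Record a tower by a word of block columns listed in an order in which the blocks can be
  dropped one after another. Among these words exactly one is normal, i.e. descends by less than
  \<open>k\<close> at every step: its last letter is the rightmost block that is not covered. The base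
  consists of the blocks whose column exceeds all earlier ones by at least \<open>k\<close>. A normal word
  with current maximum \<open>M\<close> and last letter \<open>M - e\<close> has \<open>k(m+1)+e-1\<close> choose \<open>m-r\<close> continuations
  by \<open>m\<close> letters that complete the base by \<open>r\<close> further blocks, by induction on \<open>m\<close> and the
  hockey-stick identity. Hence \<open>kn-1\<close> choose \<open>n-b\<close> towers have base \<open>b\<close>, and the sum over \<open>b\<close>
  is the terminating hypergeometric series, term by term.\<close>

section \<open>Heaps of blocks and the piles obtained by dropping blocks\<close>

text \<open>The tower conditions without any demand on the shape of the base. This class, unlike
  that of towers, is closed under removing an exposed block, so heaps can be dismantled one block at
  a time.\<close>

definition heap :: "nat \<Rightarrow> block set \<Rightarrow> bool" where
  "heap k T \<longleftrightarrow> finite T \<and> (\<forall>x l. (x, l) \<in> T \<longrightarrow> l \<ge> 0) \<and>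
     (\<forall>x y l. (x, l) \<in> T \<longrightarrow> (y, l) \<in> T \<longrightarrow> \<bar>y - x\<bar> < int k \<longrightarrow> x = y) \<and>
     (\<forall>x l. (x, l) \<in> T \<longrightarrow> l \<noteq> 0 \<longrightarrow> (\<exists>y. (y, l - 1) \<in> T \<and> \<bar>y - x\<bar> < int k))"

definition drop_level :: "nat \<Rightarrow> block set \<Rightarrow> int \<Rightarrow> int" where
  "drop_level k T x = Max (insert 0 {l + 1 |y l. (y, l) \<in> T \<and> \<bar>y - x\<bar> < int k})"

definition pile :: "nat \<Rightarrow> int list \<Rightarrow> block set" where
  "pile k w = foldl (\<lambda>T x. insert (x, drop_level k T x) T) {} w"

text \<open>A descent by \<open>k\<close> or more joins two drops that do not overlap and hence
  commute. Forbidding it selects one representative among the words that build the same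
  pile.\<close>

definition normal :: "nat \<Rightarrow> int list \<Rightarrow> bool" where
  "normal k w \<longleftrightarrow> successively (\<lambda>a b. a < b + int k) w"

definition exposed :: "nat \<Rightarrow> block set \<Rightarrow> block \<Rightarrow> bool" where
  "exposed k T B \<longleftrightarrow> B \<in> T \<and> (\<forall>(y, l) \<in> T. \<bar>y - fst B\<bar> < int k \<longrightarrow> l \<le> snd B)"

lemma finite_supports:
  assumes "finite T"
  shows "finite {l + 1 |y l. (y, l) \<in> T \<and> \<bar>y - x\<bar> < int k}"
  by (rule finite_subset[of _ "(\<lambda>B. snd B + 1) ` T"]) (use assms in force)+

lemma drop_level_nonneg: "finite T \<Longrightarrow> drop_level k T x \<ge> 0"
  unfolding drop_level_def by (rule Max_ge) (auto simp: finite_supports)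

lemma drop_level_gt:
  assumes "finite T" "(y, l) \<in> T" "\<bar>y - x\<bar> < int k"
  shows "l < drop_level k T x"
proof -
  have "l + 1 \<le> drop_level k T x"
    unfolding drop_level_def by (rule Max_ge) (use assms finite_supports in auto)
  then show ?thesis by simp
qed

lemma drop_level_cases:
  assumes "finite T"
  shows "drop_level k T x = 0 \<or> (\<exists>y. (y, drop_level k T x - 1) \<in> T \<and> \<bar>y - x\<bar> < int k)"
proof -
  have "drop_level k T x \<in> insert 0 {l + 1 |y l. (y, l) \<in> T \<and> \<bar>y - x\<bar> < int k}"
    unfolding drop_level_def by (rule Max_in) (use assms finite_supports in auto)
  then show ?thesis by auto
qed

lemma drop_level_eqI:
  assumes "finite T" "L \<ge> 0"
    and "\<And>y l. (y, l) \<in> T \<Longrightarrow> \<bar>y - x\<bar> < int k \<Longrightarrow> l < L"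
    and "L \<noteq> 0 \<Longrightarrow> \<exists>y. (y, L - 1) \<in> T \<and> \<bar>y - x\<bar> < int k"
  shows "drop_level k T x = L"
  using drop_level_cases[of T k x] drop_level_gt[of T _ _ x k] drop_level_nonneg[of T k x] assms
  by (smt (verit, best))

lemma pile_Nil [simp]: "pile k [] = {}"
  by (simp add: pile_def)

lemma pile_snoc [simp]: "pile k (u @ [x]) = insert (x, drop_level k (pile k u) x) (pile k u)"
  by (simp add: pile_def)

lemma finite_pile [simp]: "finite (pile k w)"
  by (induction w rule: rev_induct) auto

lemma fst_pile: "fst ` pile k w = set w"
  by (induction w rule: rev_induct) auto

lemma drop_fresh:
  assumes "k \<ge> 1" "finite T"
  shows "(x, drop_level k T x) \<notin> T"
  using drop_level_gt[OF assms(2), of x "drop_level k T x" x k] assms(1) by auto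

lemma card_pile: "k \<ge> 1 \<Longrightarrow> card (pile k w) = length w"
  by (induction w rule: rev_induct) (auto simp: drop_fresh)

lemma heap_pile: "heap k (pile k w)"
proof (induction w rule: rev_induct)
  case Nil
  then show ?case by (simp add: heap_def)
next
  case (snoc x u)
  let ?T = "pile k u" and ?L = "drop_level k (pile k u) x"
  have gt: "l < ?L" if "(y, l) \<in> ?T" "\<bar>y - x\<bar> < int k" for y l
    using drop_level_gt[OF finite_pile that] .
  have sup: "?L = 0 \<or> (\<exists>y. (y, ?L - 1) \<in> ?T \<and> \<bar>y - x\<bar> < int k)"
    by (rule drop_level_cases) simp
  have "?L \<ge> 0"
    by (rule drop_level_nonneg) simp
  show ?case
    unfolding heap_def
  proof (intro conjI allI impI)
    show "0 \<le> l" if "(y, l) \<in> pile k (u @ [x])" for y l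
      using that \<open>?L \<ge> 0\<close> snoc by (auto simp: heap_def)
    show "y = z" if "(y, l) \<in> pile k (u @ [x])" "(z, l) \<in> pile k (u @ [x])" "\<bar>z - y\<bar> < int k" for y z l
      using that gt[of y l] gt[of z l] snoc by (auto simp: heap_def abs_minus_commute)
    show "\<exists>z. (z, l - 1) \<in> pile k (u @ [x]) \<and> \<bar>z - y\<bar> < int k"
      if "(y, l) \<in> pile k (u @ [x])" "l \<noteq> 0" for y l
      using that sup snoc by (fastforce simp: heap_def)
  qed simp
qed

section \<open>Bijection between normal words and heaps\<close>

lemma normal_snoc:
  "normal k (u @ [x]) \<longleftrightarrow> normal k u \<and> (u \<noteq> [] \<longrightarrow> last u < x + int k)"
  by (auto simp: normal_def successively_append_iff)

lemma exposed_last: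
  assumes "w \<noteq> []"
  shows "\<exists>l. exposed k (pile k w) (last w, l)"
proof -
  obtain u x where w: "w = u @ [x]"
    using assms by (metis append_butlast_last_id)
  have "exposed k (pile k w) (x, drop_level k (pile k u) x)"
    using drop_level_gt[of "pile k u" _ _ x k] by (auto simp: exposed_def w intro: less_imp_le)
  then show ?thesis by (auto simp: w)
qed

text \<open>Suppose an earlier block \<open>C\<close> is still exposed after \<open>x\<close> has
  been dropped. By induction it is at most \<open>last u\<close>, hence less than
  \<open>x + k\<close>. The new block would lie above \<open>C\<close> if they overlapped, so the
  columns differ by at least \<open>k\<close>, which leaves only \<open>C\<close> to the left of
  \<open>x\<close>.\<close>

lemma exposed_le_last:
  assumes "normal k w" "exposed k (pile k w) C"
  shows "fst C \<le> last w"
  using assms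
proof (induction w rule: rev_induct)
  case Nil
  then show ?case by (simp add: exposed_def)
next
  case (snoc x u)
  show ?case
  proof (cases "C = (x, drop_level k (pile k u) x)")
    case False
    then have C: "C \<in> pile k u"
      using snoc.prems by (auto simp: exposed_def)
    then have "exposed k (pile k u) C" "u \<noteq> []"
      using snoc.prems by (auto simp: exposed_def)
    then have *: "fst C < x + int k"
      using snoc by (force simp: normal_snoc)
    have "\<not> \<bar>x - fst C\<bar> < int k"
      using snoc.prems(2) drop_level_gt[of "pile k u" "fst C" "snd C" x k] C
      by (auto simp: exposed_def abs_minus_commute)
    then show ?thesis using * by auto
  qed auto
qed

lemma exposed_unique:
  assumes "k \<ge> 1" "exposed k T (x, l)" "exposed k T (x, l')"
  shows "l = l'"
proof (rule antisym)
  show "l \<le> l'" "l' \<le> l"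
    using assms by (auto simp: exposed_def)
qed

text \<open>The last letter can be read off the pile as its rightmost exposed column, and that
  column has only one exposed level. So both words end with the same block, and removing it reduces
  to shorter words.\<close>

lemma pile_inj:
  assumes "k \<ge> 1" "normal k u" "normal k v" "pile k u = pile k v"
  shows "u = v"
  using assms(2-)
proof (induction u arbitrary: v rule: rev_induct)
  case Nil
  then show ?case using card_pile[OF assms(1), of v] by auto
next
  case (snoc x u)
  have "v \<noteq> []"
    using snoc.prems(3) by auto
  then obtain v' y where v: "v = v' @ [y]"
    by (metis append_butlast_last_id)
  let ?T = "pile k (u @ [x])"
  let ?l = "drop_level k (pile k u) x" and ?m = "drop_level k (pile k v') y"
  have x: "exposed k ?T (x, ?l)"
    using drop_level_gt[of "pile k u" _ _ x k] by (auto simp: exposed_def intro: less_imp_le)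
  have y: "exposed k ?T (y, ?m)"
    unfolding snoc.prems(3) v
    using drop_level_gt[of "pile k v'" _ _ y k] by (auto simp: exposed_def intro: less_imp_le)
  have "x = y"
    using exposed_le_last[OF snoc.prems(1) y]
      exposed_le_last[OF snoc.prems(2) x[unfolded snoc.prems(3)]]
    by (simp add: v)
  moreover have "?l = ?m"
    using exposed_unique[OF assms(1)] x y \<open>x = y\<close> by blast
  ultimately have "pile k u = pile k v'"
    using snoc.prems(3) drop_fresh[OF assms(1), of "pile k u" x]
      drop_fresh[OF assms(1), of "pile k v'" y] unfolding v
    by (metis finite_pile insert_ident pile_snoc)
  then show ?case
    using snoc.IH[of v'] snoc.prems \<open>x = y\<close> by (simp add: normal_snoc v)
qed

lemma finite_argmax:
  fixes f :: "'a \<Rightarrow> 'b :: linorder"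
  assumes "finite S" "S \<noteq> {}"
  obtains a where "a \<in> S" "\<And>b. b \<in> S \<Longrightarrow> f b \<le> f a"
proof -
  have "Max (f ` S) \<in> f ` S"
    using assms by simp
  then obtain a where "a \<in> S" "f a = Max (f ` S)"
    by force
  then show ?thesis
    using assms that by simp
qed

lemma exposed_exists:
  assumes "finite T" "T \<noteq> {}"
  shows "\<exists>B. exposed k T B"
proof -
  obtain B where "B \<in> T" "\<And>C. C \<in> T \<Longrightarrow> snd C \<le> snd B"
    using finite_argmax[OF assms] by blast
  then show ?thesis
    by (intro exI[of _ B]) (force simp: exposed_def)
qed

lemma heap_remove_exposed:
  assumes "heap k T" "exposed k T (x, l)"
  shows "heap k (T - {(x, l)})"
  unfolding heap_def
proof (intro conjI allI impI)
  fix y m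
  assume ym: "(y, m) \<in> T - {(x, l)}" "m \<noteq> 0"
  then obtain z where z: "(z, m - 1) \<in> T" "\<bar>z - y\<bar> < int k"
    using assms(1) unfolding heap_def by blast
  have "(z, m - 1) \<noteq> (x, l)"
    using assms(2) ym z by (auto simp: exposed_def abs_minus_commute)
  with z show "\<exists>z. (z, m - 1) \<in> T - {(x, l)} \<and> \<bar>z - y\<bar> < int k"
    by blast
qed (use assms(1) in \<open>auto simp: heap_def\<close>)

text \<open>Take away the rightmost exposed block, write the remaining heap as a normal word by
  induction, and drop the block again: it returns to its old level.\<close>

lemma pile_surj:
  assumes "k \<ge> 1" "heap k T"
  shows "\<exists>w. normal k w \<and> pile k w = T"
  using assms(2)
proof (induction "card T" arbitrary: T)
  case 0
  then have "T = {}" by (simp add: heap_def)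
  then show ?case by (intro exI[of _ "[]"]) (simp add: normal_def)
next
  case (Suc c)
  have fin: "finite T"
    using Suc.prems by (simp add: heap_def)
  have "finite {B. exposed k T B}"
    by (rule finite_subset[OF _ fin]) (auto simp: exposed_def)
  moreover have "{B. exposed k T B} \<noteq> {}"
    using exposed_exists[OF fin, of k] Suc.hyps(2) by force
  ultimately obtain x l
    where ex: "exposed k T (x, l)" and right: "\<And>C. exposed k T C \<Longrightarrow> fst C \<le> x"
    using finite_argmax[of "{B. exposed k T B}" fst] by (metis fst_conv mem_Collect_eq surj_pair)
  have inT: "(x, l) \<in> T"
    using ex by (simp add: exposed_def)
  have "c = card (T - {(x, l)})"
    using Suc.hyps(2) inT fin by simp
  then obtain u where u: "normal k u" "pile k u = T - {(x, l)}"
    using Suc.hyps(1) heap_remove_exposed[OF Suc.prems ex] by blast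
  have "drop_level k (T - {(x, l)}) x = l"
  proof (rule drop_level_eqI)
    show "l \<ge> 0"
      using Suc.prems inT by (auto simp: heap_def)
    show "m < l" if "(y, m) \<in> T - {(x, l)}" "\<bar>y - x\<bar> < int k" for y m
    proof -
      have "m \<le> l"
        using ex that by (auto simp: exposed_def)
      moreover have "m \<noteq> l"
        using Suc.prems inT that by (auto simp: heap_def)
      ultimately show ?thesis by simp
    qed
    show "\<exists>y. (y, l - 1) \<in> T - {(x, l)} \<and> \<bar>y - x\<bar> < int k" if raised: "l \<noteq> 0"
    proof -
      obtain y where "(y, l - 1) \<in> T" "\<bar>y - x\<bar> < int k"
        using Suc.prems inT raised unfolding heap_def by blast
      then show ?thesis by auto
    qed
  qed (use fin in auto)
  then have pile: "pile k (u @ [x]) = T"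
    using u inT by auto
  have "last u < x + int k" if nonempty: "u \<noteq> []"
  proof (rule ccontr)
    \<comment> \<open>The last block of \<open>u\<close> would then be too far right to overlap the
      removed block, so it would be exposed in \<open>T\<close> as well, contradicting the choice of
      \<open>x\<close> as rightmost.\<close>
    assume far: "\<not> last u < x + int k"
    obtain m where "exposed k (pile k u) (last u, m)"
      using exposed_last[OF nonempty] by blast
    then have "exposed k (insert (x, l) (pile k u)) (last u, m)"
      using far by (simp add: exposed_def)
    moreover have "insert (x, l) (pile k u) = T"
      using u(2) inT by blast
    ultimately have "fst (last u, m) \<le> x"
      using right by metis
    then show False
      using far assms(1) by simp
  qed
  then show ?case
    using pile u by (intro exI[of _ "u @ [x]"]) (simp add: normal_snoc)
qed

section \<open>The base of a pile\<close>

text \<open>Since a normal word descends by less than \<open>k\<close> at a time, it cannot cross the window of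
  letters overlapping \<open>x\<close> without entering it.\<close>

lemma normal_overlap:
  assumes "normal k u" "u \<noteq> []" "last u < x + int k" "x < Max (set u) + int k"
  shows "\<exists>a\<in>set u. \<bar>a - x\<bar> < int k"
  using assms
proof (induction u rule: rev_induct)
  case (snoc a u)
  show ?case
  proof (cases "x < a + int k")
    case True
    then show ?thesis using snoc.prems by auto
  next
    case False
    then have u: "u \<noteq> []"
      using snoc.prems by auto
    then have "last u < x + int k" "x < Max (set u) + int k"
      using snoc.prems False by (auto simp: normal_snoc max_def split: if_splits)
    then show ?thesis using snoc u by (auto simp: normal_snoc)
  qed
qed simp

definition bases :: "nat \<Rightarrow> int list \<Rightarrow> int set" where
  "bases k w = {x. (x, 0) \<in> pile k w}"

lemma bases_subset: "bases k w \<subseteq> set w"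
  using fst_pile[of k w] by (force simp: bases_def)

lemma bases_single: "bases k [x] = {x}"
  using drop_level_cases[of "{}" k x] pile_snoc[of k "[]" x] by (auto simp: bases_def)

text \<open>Below \<open>Max (set u) + k\<close>, normality forces an overlap with some earlier
  block, so the new block lands above the ground. From there on nothing overlaps it and it falls to
  level 0.\<close>

lemma bases_snoc:
  assumes "normal k (u @ [x])" "u \<noteq> []"
  shows "bases k (u @ [x]) = (if x < Max (set u) + int k then bases k u else insert x (bases k u))"
proof (cases "x < Max (set u) + int k")
  case True
  then obtain a where "a \<in> set u" "\<bar>a - x\<bar> < int k"
    using normal_overlap[of k u x] assms by (auto simp: normal_snoc)
  then obtain l where al: "(a, l) \<in> pile k u"
    using fst_pile[of k u] by force
  then have "l \<ge> 0"
    using heap_pile[of k u] by (auto simp: heap_def)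
  then have "drop_level k (pile k u) x > 0"
    using drop_level_gt[OF finite_pile al \<open>\<bar>a - x\<bar> < int k\<close>] by simp
  then show ?thesis using True by (auto simp: bases_def)
next
  case False
  have "drop_level k (pile k u) x = 0"
  proof (rule ccontr)
    assume "drop_level k (pile k u) x \<noteq> 0"
    then obtain y l where y: "(y, l) \<in> pile k u" "\<bar>y - x\<bar> < int k"
      using drop_level_cases[of "pile k u" k x] by auto
    then have "y \<in> set u"
      using fst_pile[of k u] by force
    then have "y \<le> Max (set u)" by simp
    then show False using False y by simp
  qed
  then show ?thesis using False by (auto simp: bases_def)
qed

text \<open>Base blocks are never lost, and new ones appear only beyond the current maximum. Hence a
  base position that has been passed over can never be filled later, which allows the base to be
  checked letter by letter.\<close>

lemma bases_append:
  assumes "normal k (u @ v)" "u \<noteq> []"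
  shows "bases k u \<subseteq> bases k (u @ v) \<and>
    bases k (u @ v) \<subseteq> bases k u \<union> {y. y \<ge> Max (set u) + int k}"
  using assms(1)
proof (induction v rule: rev_induct)
  case (snoc x v)
  define L where "L = Max (set u)"
  define M where "M = Max (set (u @ v))"
  have "normal k (u @ v)" and n: "normal k ((u @ v) @ [x])"
    using snoc.prems normal_snoc[of k "u @ v" x] by auto
  moreover have "L \<le> M"
    unfolding L_def M_def using assms(2) by (intro Max_mono) auto
  ultimately show ?case
    unfolding L_def[symmetric]
    using snoc.IH[folded L_def] bases_snoc[OF n, folded M_def] assms(2) by auto
qed simp

section \<open>Normal words with a contiguous base\<close>

text \<open>The base of \<open>b\<close> adjacent blocks that starts at column 0; this fixes one
  representative per translation class.\<close>

definition run :: "nat \<Rightarrow> nat \<Rightarrow> int set" where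
  "run k b = (\<lambda>j. int (j * k)) ` {..<b}"

lemma run_mem_iff: "k \<ge> 1 \<Longrightarrow> int (j * k) \<in> run k b \<longleftrightarrow> j < b"
  by (auto simp: run_def)

lemma run_Suc: "run k (Suc b) = insert (int (b * k)) (run k b)"
  by (simp add: run_def lessThan_Suc)

lemma run_nonneg: "x \<in> run k b \<Longrightarrow> 0 \<le> x"
  by (auto simp: run_def)

text \<open>\<open>continuation k r M w xs\<close>: the letters \<open>xs\<close> extend a normal word with maximum \<open>M\<close> and last
  letter \<open>w\<close>, adding exactly \<open>r\<close> blocks to the contiguous base. Until the last base block is
  placed, no letter may exceed the rightmost base block, which is then \<open>M\<close>.\<close>

fun continuation :: "nat \<Rightarrow> nat \<Rightarrow> int \<Rightarrow> int \<Rightarrow> int list \<Rightarrow> bool" where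
  "continuation k r M w [] \<longleftrightarrow> r = 0"
| "continuation k r M w (x # xs) \<longleftrightarrow> w < x + int k \<and>
     (if x \<le> M then continuation k r M x xs
      else if r = 0 then x < M + int k \<and> continuation k 0 x x xs
      else x = M + int k \<and> continuation k (r - 1) x x xs)"

text \<open>While \<open>r > 0\<close>, the next base block must stand at \<open>M + k\<close>. A
  letter strictly between \<open>M\<close> and \<open>M + k\<close> raises the maximum without
  joining the base, and a letter beyond \<open>M + k\<close> leaves a gap; by
  \<open>bases_append\<close> neither can be repaired. Once \<open>r = 0\<close>, a letter from
  \<open>M + k\<close> on would be a surplus base block, while smaller letters may raise the maximum
  freely. Therefore the maximum is tied to the base only for \<open>r > 0\<close>.\<close>

lemma continuation_iff:
  assumes "k \<ge> 1" "j \<ge> 1" "u \<noteq> []" "normal k u" "bases k u = run k j"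
    and "r > 0 \<Longrightarrow> Max (set u) = int ((j - 1) * k)"
  shows "continuation k r (Max (set u)) (last u) xs \<longleftrightarrow>
    normal k (u @ xs) \<and> bases k (u @ xs) = run k (j + r)"
  using assms(2-)
proof (induction xs arbitrary: u r j)
  case Nil
  have "run k j = run k (j + r) \<longleftrightarrow> r = 0"
    using run_mem_iff[OF assms(1), of j] by (metis add.right_neutral less_add_same_cancel1 neq0_conv)
  then show ?case using Nil by simp
next
  case (Cons x xs)
  define M where "M = Max (set u)"
  have "continuation k r M (last u) (x # xs) \<longleftrightarrow>
      normal k (u @ x # xs) \<and> bases k (u @ x # xs) = run k (j + r)"
  proof (cases "last u < x + int k")
    case False
    then have "\<not> normal k (u @ x # xs)"
      using Cons.prems by (auto simp: normal_def successively_append_iff)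
    then show ?thesis using False by simp
  next
    case step: True
    then have n: "normal k (u @ [x])"
      using Cons.prems by (simp add: normal_snoc)
    note base = bases_snoc[OF n \<open>u \<noteq> []\<close>, folded M_def]
    have Max: "Max (set (u @ [x])) = max x M"
      using \<open>u \<noteq> []\<close> by (simp add: M_def)
    have IH: "continuation k r' (max x M) x xs \<longleftrightarrow>
        normal k (u @ x # xs) \<and> bases k (u @ x # xs) = run k (j' + r')"
      if "j' \<ge> 1" "bases k (u @ [x]) = run k j'" "r' > 0 \<Longrightarrow> max x M = int ((j' - 1) * k)" for j' r'
      using Cons.IH[of j' "u @ [x]" r'] that n Max by simp
    have later: "bases k (u @ [x]) \<subseteq> bases k (u @ x # xs)"
      "bases k (u @ x # xs) \<subseteq> bases k (u @ [x]) \<union> {y. y \<ge> max x M + int k}"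
      if "normal k (u @ x # xs)"
      using bases_append[of k "u @ [x]" xs] that Max by auto
    have next_base: "int (j * k) = M + int k" if "r > 0"
      using Cons.prems(5)[OF that, folded M_def] Cons.prems(1) by (cases j) (auto simp: algebra_simps)
    \<comment> \<open>The column \<open>j * k\<close> is the test position in both failing cases
      with \<open>r > 0\<close>: it is not yet in the base but has to be in the end.\<close>
    have fresh: "int (j * k) \<notin> run k j" and final: "r > 0 \<Longrightarrow> int (j * k) \<in> run k (j + r)"
      using run_mem_iff[OF assms(1)] by auto
    consider "x \<le> M" | "M < x" "x < M + int k" | "M + int k \<le> x"
      by linarith
    then show ?thesis
    proof cases
      case 1
      then have "bases k (u @ [x]) = run k j"
        using base Cons.prems assms(1) by simp
      moreover have max: "max x M = M"
        using 1 by simp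
      ultimately show ?thesis
        using IH[of j r, unfolded max] 1 step Cons.prems(1) Cons.prems(5)[folded M_def] by simp
    next
      case 2
      then have b: "bases k (u @ [x]) = run k j"
        using base Cons.prems by simp
      show ?thesis
      proof (cases "r = 0")
        case True
        then show ?thesis using IH[of j 0] b 2 step Cons.prems by (simp add: max_def)
      next
        case False
        have "bases k (u @ x # xs) \<noteq> run k (j + r)" if "normal k (u @ x # xs)"
          using later(2)[OF that] fresh final next_base b False 2 by auto
        then show ?thesis using False 2 assms(1) by auto
      qed
    next
      case 3
      then have b: "bases k (u @ [x]) = insert x (run k j)"
        using base Cons.prems by simp
      have "x \<notin> set u"
      proof
        assume "x \<in> set u"
        then have "x \<le> M"
          unfolding M_def by (rule Max_ge[OF finite_set])
        then show False using 3 assms(1) by simp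
      qed
      then have new: "x \<notin> run k j"
        using bases_subset[of k u] Cons.prems by auto
      consider "r = 0" | "r > 0" "x = M + int k" | "r > 0" "x > M + int k"
        using 3 by linarith
      then show ?thesis
      proof cases
        case 1
        then have "bases k (u @ x # xs) \<noteq> run k (j + r)" if "normal k (u @ x # xs)"
          using later(1)[OF that] b new by auto
        then show ?thesis using 1 3 assms(1) by auto
      next
        case 2
        then have "bases k (u @ [x]) = run k (Suc j)"
          using b next_base by (simp add: run_Suc)
        then show ?thesis
          using IH[of "Suc j" "r - 1"] 2 step next_base assms(1) by (simp add: max_def)
      next
        case 3
        have "bases k (u @ x # xs) \<noteq> run k (j + r)" if "normal k (u @ x # xs)"
          using later(2)[OF that] fresh final next_base b 3 by auto
        then show ?thesis using 3 by auto
      qed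
    qed
  qed
  then show ?case
    unfolding M_def .
qed

text \<open>The first letter is always a base block, and all other base blocks lie to its right. A
  base that starts at 0 therefore forces the first letter to be 0.\<close>

lemma normal_run_iff:
  assumes "k \<ge> 1" "b \<ge> 1"
  shows "normal k w \<and> bases k w = run k b \<longleftrightarrow>
    (\<exists>xs. w = 0 # xs \<and> continuation k (b - 1) 0 0 xs)"
proof -
  have run1: "run k 1 = {0}"
    by (auto simp: run_def)
  have cont: "continuation k (b - 1) 0 0 xs \<longleftrightarrow> normal k (0 # xs) \<and> bases k (0 # xs) = run k b" for xs
    using continuation_iff[of k 1 "[0]" "b - 1" xs] assms bases_single[of k 0] run1
    by (simp add: normal_def)
  have "\<exists>xs. w = 0 # xs" if norm: "normal k w" and base: "bases k w = run k b"
  proof -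
    have zero: "0 \<in> run k b"
      using run_mem_iff[of k 0 b] assms by simp
    then obtain x xs where w: "w = x # xs"
      using base bases_subset[of k w] by (cases w) auto
    have "bases k w \<subseteq> {x} \<union> {y. y \<ge> x + int k}" "x \<in> bases k w"
      using bases_append[of k "[x]" xs] norm w bases_single[of k x] by auto
    then have "x = 0"
      using zero base run_nonneg[of x k b] by auto
    with w show ?thesis by blast
  qed
  then show ?thesis using cont by auto
qed

section \<open>Counting continuations\<close>

text \<open>Hockey-stick identity for \<open>c\<close> consecutive upper indices, with the part of
  the sum below \<open>N\<close> collapsed into one binomial coefficient, the edge term.\<close>

lemma sum_choose_window: "(\<Sum>e<c. (N + e) choose m) + (N choose Suc m) = (N + c) choose Suc m"
  by (induction c) auto

lemma binomial_Suc_step: "Suc j * (N choose Suc j) = (N - j) * (N choose j)"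
  using binomial_absorb_comp[of N j] binomial_absorption[of j N] by simp

text \<open>For \<open>N = k * (m + 1) - 1\<close> one has \<open>N - m = (k - 1) * (m + 1)\<close>,
  so the two neighbouring binomials have ratio \<open>k - 1\<close>. With a complete base, the
  \<open>k - 1\<close> letters that raise the maximum thus contribute exactly the edge term of the
  hockey-stick sum.\<close>

lemma choose_edge: "(k - 1) * ((k * (m + 1) - 1) choose m) = (k * (m + 1) - 1) choose (Suc m)"
proof (cases "k = 0")
  case False
  let ?N = "k * (m + 1) - 1"
  have N: "?N - m = (k - 1) * Suc m"
    using False by (cases k) auto
  have "Suc m * (?N choose Suc m) = Suc m * ((k - 1) * (?N choose m))"
    unfolding binomial_Suc_step N by (simp only: ac_simps)
  then show ?thesis by (metis Suc_neq_Zero mult_cancel1)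
qed simp

lemma card_Cons_family:
  assumes "finite A" "\<And>x. x \<in> A \<Longrightarrow> finite (S x)"
  shows "finite (\<Union>x\<in>A. (#) x ` S x)" "card (\<Union>x\<in>A. (#) x ` S x) = (\<Sum>x\<in>A. card (S x))"
proof -
  have "card (\<Union>x\<in>A. (#) x ` S x) = (\<Sum>x\<in>A. card ((#) x ` S x))"
    using assms by (intro card_UN_disjoint) auto
  then show "card (\<Union>x\<in>A. (#) x ` S x) = (\<Sum>x\<in>A. card (S x))"
    by (simp add: card_image)
qed (use assms in auto)

text \<open>Split by the first letter. A letter \<open>M - e\<close> leaves \<open>?N + e\<close>
  choose \<open>m - r\<close> words, for a window of \<open>nat (M - w) + k\<close> values of
  \<open>e\<close>. Letters above \<open>M\<close> reset the distance to 0 and together supply the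
  edge term \<open>?N\<close> choose \<open>Suc (m - r)\<close>: \<open>k - 1\<close> of them if
  \<open>r = 0\<close>, otherwise a single base block with \<open>r - 1\<close> left to
  place.\<close>

lemma card_continuation:
  assumes "k \<ge> 1" "w \<le> M"
  shows "finite {xs. length xs = m \<and> continuation k r M w xs} \<and>
    card {xs. length xs = m \<and> continuation k r M w xs} =
      (if r \<le> m then (k * (m + 1) - 1 + nat (M - w)) choose (m - r) else 0)"
  using assms(2)
proof (induction m arbitrary: r M w)
  case 0
  have "{xs. length xs = 0 \<and> continuation k r M w xs} = (if r = 0 then {[]} else {})"
    by auto
  then show ?case by simp
next
  case (Suc m)
  define S where "S r M w = {xs. length xs = m \<and> continuation k r M w xs}" for r M w
  \<comment> \<open>\<open>A\<close> holds the admissible first letters that keep the maximum,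
    \<open>B\<close> those that raise it.\<close>
  define A where "A = {w - int k + 1..M}"
  define B where "B = (if r = 0 then {M + 1..<M + int k} else {M + int k})"
  define F where "F x = (if x \<le> M then S r M x else S (r - 1) x x)" for x
  let ?N = "k * (m + 1) - 1"
  have fin: "finite (S r M w)"
    and card: "card (S r M w) = (if r \<le> m then (?N + nat (M - w)) choose (m - r) else 0)"
    if "w \<le> M" for r M w
    using Suc.IH[OF that] by (auto simp: S_def)
  have split: "{xs. length xs = Suc m \<and> continuation k r M w xs} = (\<Union>x\<in>A \<union> B. (#) x ` F x)"
    (is "?L = ?R")
  proof (intro set_eqI)
    fix xs
    show "xs \<in> ?L \<longleftrightarrow> xs \<in> ?R"
      using Suc.prems assms(1)
      by (cases xs) (auto simp: A_def B_def F_def S_def)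
  qed
  have finF: "finite (F x)" for x
    by (simp add: F_def fin)
  have finAB: "finite A" "finite B" and disj: "A \<inter> B = {}"
    using assms(1) by (auto simp: A_def B_def)
  have "card ?L = (\<Sum>x\<in>A. card (F x)) + (\<Sum>x\<in>B. card (F x))"
    unfolding split card_Cons_family(2)[OF finite_UnI[OF finAB] finF]
    by (rule sum.union_disjoint[OF finAB disj])
  also have "(\<Sum>x\<in>A. card (F x)) = (\<Sum>x\<in>A. card (S r M x))"
    by (intro sum.cong) (auto simp: A_def F_def)
  also have "\<dots> = (\<Sum>e<nat (M - w) + k. if r \<le> m then (?N + e) choose (m - r) else 0)"
    by (rule sum.reindex_bij_witness[of _ "\<lambda>e. M - int e" "\<lambda>x. nat (M - x)"])
      (use Suc.prems in \<open>auto simp: A_def card\<close>)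
  also have "(\<Sum>x\<in>B. card (F x)) = card B * (if r - 1 \<le> m then ?N choose (m - (r - 1)) else 0)"
    using assms(1) by (auto simp: B_def F_def card)
  finally have card_eq: "card ?L = (\<Sum>e<nat (M - w) + k. if r \<le> m then (?N + e) choose (m - r) else 0) +
      card B * (if r - 1 \<le> m then ?N choose (m - (r - 1)) else 0)" .
  \<comment> \<open>One more letter increases \<open>?N\<close> by \<open>k\<close>, which is the
    part of the window width that does not depend on \<open>M - w\<close>.\<close>
  have top: "k * (Suc m + 1) - 1 + nat (M - w) = ?N + (nat (M - w) + k)"
    using assms(1) by (simp add: algebra_simps)
  consider "r = 0" | "r > 0" "r \<le> m" | "r = Suc m" | "r > Suc m"
    by linarith
  then have "card ?L = (if r \<le> Suc m then (?N + (nat (M - w) + k)) choose (Suc m - r) else 0)"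
  proof cases
    case 1
    then have "card B = k - 1"
      by (simp add: B_def nat_diff_distrib)
    then have "card ?L = (\<Sum>e<nat (M - w) + k. (?N + e) choose m) + (k - 1) * (?N choose m)"
      using card_eq 1 by simp
    then show ?thesis
      unfolding choose_edge sum_choose_window using 1 by simp
  next
    case 2
    then have "card ?L = (\<Sum>e<nat (M - w) + k. (?N + e) choose (m - r)) + (?N choose Suc (m - r))"
      using card_eq by (simp add: B_def Suc_diff_le)
    then show ?thesis
      unfolding sum_choose_window using 2 by (simp add: Suc_diff_le)
  qed (use card_eq in \<open>auto simp: B_def\<close>)
  moreover have "finite ?L"
    unfolding split using finAB finF by (intro card_Cons_family(1)) auto
  ultimately show ?case
    unfolding top by blast
qed

section \<open>Counting heaps with a given base\<close>

definition ground :: "block set \<Rightarrow> int set" where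
  "ground T = {x. (x, 0) \<in> T}"

lemma card_based_heaps:
  assumes "k \<ge> 1" "1 \<le> b" "b \<le> n"
  defines "H \<equiv> {T. heap k T \<and> card T = n \<and> ground T = run k b}"
  shows "finite H" "card H = (k * n - 1) choose (n - b)"
proof -
  let ?W = "{w. normal k w \<and> length w = n \<and> bases k w = run k b}"
  let ?C = "{xs. length xs = n - 1 \<and> continuation k (b - 1) 0 0 xs}"
  have W: "?W = (#) 0 ` ?C"
  proof -
    have "?W = {w. (normal k w \<and> bases k w = run k b) \<and> length w = n}"
      by auto
    also have "\<dots> = (#) 0 ` ?C"
      unfolding normal_run_iff[OF assms(1,2)] using assms(2,3) by auto
    finally show ?thesis .
  qed
  have "bij_betw (pile k) ?W H"
    unfolding bij_betw_def
  proof
    show "inj_on (pile k) ?W"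
      using pile_inj[OF assms(1)] by (auto intro!: inj_onI)
    show "pile k ` ?W = H"
      using pile_surj[OF assms(1)] heap_pile card_pile[OF assms(1)]
      by (fastforce simp: H_def ground_def bases_def)
  qed
  then have "finite ?W \<longleftrightarrow> finite H" "card ?W = card H"
    by (rule bij_betw_finite, rule bij_betw_same_card)
  then have "finite H \<longleftrightarrow> finite ?W" "card H = card ?W"
    by simp_all
  moreover have "finite ?C" "card ?C = (k * n - 1) choose (n - b)"
    \<comment> \<open>The leading 0 leaves \<open>m = n - 1\<close> letters and
      \<open>r = b - 1\<close> base blocks at distance 0, so \<open>k * (m + 1) - 1\<close> is
      \<open>k * n - 1\<close> and \<open>m - r\<close> is \<open>n - b\<close>.\<close>
    using card_continuation[OF assms(1), of 0 0 "n - 1" "b - 1"] assms(2,3) by simp_all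
  ultimately show "finite H" "card H = (k * n - 1) choose (n - b)"
    unfolding W by (simp_all add: card_image)
qed

section \<open>Towers as heaps with a contiguous base\<close>

lemma columns_Int_iff:
  "k \<ge> 1 \<Longrightarrow> columns k (x, l) \<inter> columns k (y, m) \<noteq> {} \<longleftrightarrow> \<bar>x - y\<bar> < int k"
  by (auto simp: columns_def)

lemma omino_tower_iff:
  assumes "k \<ge> 1"
  shows "omino_tower k n b T \<longleftrightarrow> heap k T \<and> card T = n \<and> card (ground T) = b \<and>
    (\<exists>x. (\<Union>a\<in>ground T. {a..<a + int k}) = {x..<x + int (b * k)})"
proof -
  have base: "base T = (\<lambda>x. (x, 0)) ` ground T"
    by (auto simp: base_def level_def ground_def)
  have card: "card (base T) = card (ground T)"
    unfolding base by (simp add: card_image inj_on_def)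
  have union: "(\<Union>B\<in>base T. columns k B) = (\<Union>a\<in>ground T. {a..<a + int k})"
    unfolding base by (simp add: columns_def)
  have disj: "disjoint_family_on (cells k) T \<longleftrightarrow>
      (\<forall>x y l. (x, l) \<in> T \<longrightarrow> (y, l) \<in> T \<longrightarrow> \<bar>y - x\<bar> < int k \<longrightarrow> x = y)"
  proof -
    have "cells k (x, l) \<inter> cells k (y, m) = {} \<longleftrightarrow> \<not> (l = m \<and> \<bar>y - x\<bar> < int k)" for x y l m
      using columns_Int_iff[OF assms, of x l y m] by (auto simp: cells_def level_def abs_minus_commute)
    then have "disjoint_family_on (cells k) T \<longleftrightarrow> (\<forall>x l. (x, l) \<in> T \<longrightarrow>
        (\<forall>y m. (y, m) \<in> T \<longrightarrow> (x, l) \<noteq> (y, m) \<longrightarrow> \<not> (l = m \<and> \<bar>y - x\<bar> < int k)))"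
      by (simp only: disjoint_family_on_def Ball_def split_paired_All)
    then show ?thesis
      by (simp only: prod.inject) blast
  qed
  have below: "(\<exists>C\<in>T. level C = level (x, l) - 1 \<and> columns k C \<inter> columns k (x, l) \<noteq> {}) \<longleftrightarrow>
      (\<exists>y. (y, l - 1) \<in> T \<and> \<bar>y - x\<bar> < int k)" for x l
    by (simp only: Bex_def split_paired_Ex level_def snd_conv columns_Int_iff[OF assms]) blast
  have mem: "(x, l) \<in> T - base T \<longleftrightarrow> (x, l) \<in> T \<and> l \<noteq> 0" for x l
    by (auto simp: base_def level_def)
  have nonneg: "(\<forall>x l. (x, l) \<in> T \<longrightarrow> l \<ge> 0) \<longleftrightarrow> (\<forall>x l. (x, l) \<in> T \<longrightarrow> l \<noteq> 0 \<longrightarrow> l \<ge> 1)"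
    by force
  have support: "(\<forall>B\<in>T - base T. level B \<ge> 1 \<and>
        (\<exists>C\<in>T. level C = level B - 1 \<and> columns k C \<inter> columns k B \<noteq> {})) \<longleftrightarrow>
      (\<forall>x l. (x, l) \<in> T \<longrightarrow> l \<ge> 0) \<and>
      (\<forall>x l. (x, l) \<in> T \<longrightarrow> l \<noteq> 0 \<longrightarrow> (\<exists>y. (y, l - 1) \<in> T \<and> \<bar>y - x\<bar> < int k))"
    unfolding Ball_def split_paired_All mem below nonneg
    unfolding level_def snd_conv by blast
  show ?thesis
    unfolding omino_tower_def heap_def card union disj support by blast
qed

lemma Union_run: "(\<Union>a\<in>(+) x ` run k b. {a..<a + int k}) = {x..<x + int (b * k)}"
proof (induction b)
  case (Suc b)
  have "(\<Union>a\<in>(+) x ` run k (Suc b). {a..<a + int k}) =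
      {x + int (b * k)..<x + int (b * k) + int k} \<union> {x..<x + int (b * k)}"
    by (simp only: run_Suc image_insert Union_insert Suc.IH)
  also have "\<dots> = {x..<x + int (b * k)} \<union> {x + int (b * k)..<x + int (b * k) + int k}"
    by (rule Un_commute)
  also have "\<dots> = {x..<x + int (b * k) + int k}"
    by (rule ivl_disj_un) auto
  also have "\<dots> = {x..<x + int (Suc b * k)}"
    by (simp add: algebra_simps)
  finally show ?case .
qed (simp add: run_def)

text \<open>The block covering cell \<open>x\<close> cannot start further left, as its own first
  cell lies in the interval. So it starts at \<open>x\<close>; the remaining blocks start at
  \<open>x + k\<close> or later and tile the rest of the interval.\<close>

lemma tiling_eq_run:
  assumes "k \<ge> 1" "finite A" "card A = b"
    and "\<And>a c. a \<in> A \<Longrightarrow> c \<in> A \<Longrightarrow> \<bar>c - a\<bar> < int k \<Longrightarrow> a = c"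
    and "(\<Union>a\<in>A. {a..<a + int k}) = {x..<x + int (b * k)}"
  shows "A = (+) x ` run k b"
  using assms(2-)
proof (induction b arbitrary: A x)
  case 0
  then show ?case by (simp add: run_def)
next
  case (Suc b)
  have "x \<in> (\<Union>a\<in>A. {a..<a + int k})"
    unfolding Suc.prems(4) using assms(1) by (simp add: add_pos_nonneg)
  then obtain a where a: "a \<in> A" "a \<le> x" "x < a + int k"
    by auto
  then have "a \<in> {x..<x + int (Suc b * k)}"
    unfolding Suc.prems(4)[symmetric] using assms(1) by auto
  with a have x: "x \<in> A" by simp
  have apart: "x + int k \<le> c" if "c \<in> A - {x}" for c
  proof -
    have "c \<in> {x..<x + int (Suc b * k)}"
      unfolding Suc.prems(4)[symmetric] using assms(1) that by auto
    moreover have "\<not> \<bar>c - x\<bar> < int k"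
      using Suc.prems(3)[OF x, of c] that by blast
    ultimately show ?thesis by auto
  qed
  have "(\<Union>a\<in>A - {x}. {a..<a + int k}) = (\<Union>a\<in>A. {a..<a + int k}) - {x..<x + int k}"
    using apart x by fastforce
  also have "\<dots> = {x + int k..<x + int k + int (b * k)}"
    unfolding Suc.prems(4) by (auto simp: algebra_simps)
  finally have "A - {x} = (+) (x + int k) ` run k b"
    using Suc.prems x by (intro Suc.IH) auto
  also have "\<dots> = (+) x ` (\<lambda>j. int (j * k)) ` Suc ` {..<b}"
    by (simp add: run_def image_image algebra_simps)
  finally have "A = insert x ((+) x ` (\<lambda>j. int (j * k)) ` Suc ` {..<b})"
    using insert_Diff[OF x] by metis
  then show ?case
    by (simp add: run_def lessThan_Suc_eq_insert_0)
qed

lemma card_run: "k \<ge> 1 \<Longrightarrow> card (run k b) = b"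
  by (simp add: run_def card_image inj_on_def)

lemma towers_of_area_iff:
  assumes "k \<ge> 1"
  shows "T \<in> towers_of_area k n \<longleftrightarrow>
    heap k T \<and> card T = n \<and> (\<exists>b\<in>{1..n}. \<exists>x. ground T = (+) x ` run k b)"
proof -
  have key: "card (ground T) = b \<and> (\<exists>x. (\<Union>a\<in>ground T. {a..<a + int k}) = {x..<x + int (b * k)}) \<longleftrightarrow>
      (\<exists>x. ground T = (+) x ` run k b)" (is "?L \<longleftrightarrow> ?R") if "heap k T" for b
  proof
    have "finite (ground T)"
      by (rule finite_subset[of _ "fst ` T"]) (use that in \<open>force simp: ground_def heap_def\<close>)+
    then show "?R" if ?L
      using that tiling_eq_run[OF assms, of "ground T" b] \<open>heap k T\<close>
      by (auto simp: ground_def heap_def)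
    show "?L" if ?R
      using that Union_run card_run[OF assms, of b] by (auto simp: card_image)
  qed
  have tower: "omino_tower k n b T \<longleftrightarrow> heap k T \<and> card T = n \<and> (\<exists>x. ground T = (+) x ` run k b)" for b
    unfolding omino_tower_iff[OF assms] using key[of b] by blast
  show ?thesis
    unfolding towers_of_area_def mem_Collect_eq tower Bex_def atLeastAtMost_iff by blast
qed

section \<open>Translation classes of towers\<close>

lemma mem_htranslate_iff: "(x, l) \<in> htranslate d T \<longleftrightarrow> (x - d, l) \<in> T"
  by (force simp: htranslate_def)

lemma htranslate_0: "htranslate 0 T = T"
  by (auto simp: htranslate_def)

lemma card_htranslate: "card (htranslate d T) = card T"
  unfolding htranslate_def by (rule card_image) (auto simp: inj_on_def)

lemma ground_htranslate: "ground (htranslate d T) = (+) d ` ground T"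
  by (force simp: ground_def mem_htranslate_iff intro: rev_image_eqI)

lemma heap_htranslate:
  assumes "heap k T"
  shows "heap k (htranslate d T)"
  unfolding heap_def mem_htranslate_iff
proof (intro conjI allI impI)
  show "finite (htranslate d T)"
    using assms by (simp add: heap_def htranslate_def)
  show "0 \<le> l" if "(x - d, l) \<in> T" for x l
    using assms that by (auto simp: heap_def)
  show "x = y" if "(x - d, l) \<in> T" "(y - d, l) \<in> T" "\<bar>y - x\<bar> < int k" for x y l
  proof -
    have "\<bar>(y - d) - (x - d)\<bar> < int k"
      using that(3) by simp
    then have "x - d = y - d"
      using assms that(1,2) unfolding heap_def by blast
    then show ?thesis by simp
  qed
  show "\<exists>y. (y - d, l - 1) \<in> T \<and> \<bar>y - x\<bar> < int k" if above: "(x - d, l) \<in> T" "l \<noteq> 0" for x l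
  proof -
    obtain z where "(z, l - 1) \<in> T" "\<bar>z - (x - d)\<bar> < int k"
      using assms above unfolding heap_def by blast
    then show ?thesis
      by (intro exI[of _ "z + d"]) (auto simp: algebra_simps)
  qed
qed

text \<open>Each translation class contains exactly one tower whose base starts at column 0. These
  representatives form \<open>R\<close> and are sorted by the size of their base.\<close>

lemma num_towers_eq_sum:
  assumes "k \<ge> 1"
  shows "num_towers k n = (\<Sum>b\<in>{1..n}. (k * n - 1) choose (n - b))"
proof -
  define H where "H b = {T. heap k T \<and> card T = n \<and> ground T = run k b}" for b
  define R where "R = (\<Union>b\<in>{1..n}. H b)"
  let ?E = "htranslate_rel k n" and ?A = "towers_of_area k n"
  have RA: "R \<subseteq> ?A"
  proof
    fix T assume "T \<in> R"
    then obtain b where "b \<in> {1..n}" "heap k T" "card T = n" "ground T = (+) 0 ` run k b"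
      by (auto simp: R_def H_def)
    then show "T \<in> ?A"
      unfolding towers_of_area_iff[OF assms] by blast
  qed
  have zero: "0 \<in> run k b" if "b \<in> {1..n}" for b
    using run_mem_iff[OF assms, of 0 b] that by simp
  have "bij_betw (\<lambda>T. ?E `` {T}) R (?A // ?E)"
    unfolding bij_betw_def
  proof
    show "inj_on (\<lambda>T. ?E `` {T}) R"
    proof (rule inj_onI)
      fix S T assume ST: "S \<in> R" "T \<in> R" "?E `` {S} = ?E `` {T}"
      then have "(S, T) \<in> ?E"
        using eq_equiv_class_iff[OF equiv_htranslate_rel] RA by blast
      then obtain d where d: "T = htranslate d S"
        by (auto simp: htranslate_rel_def)
      obtain b c where bc: "b \<in> {1..n}" "c \<in> {1..n}" "ground S = run k b" "ground T = run k c"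
        using ST by (auto simp: R_def H_def)
      then have eq: "run k c = (+) d ` run k b"
        using ground_htranslate[of d S] d by simp
      \<comment> \<open>Both runs have least element 0, so a shift taking one to the other is
        neither positive nor negative.\<close>
      have "d + 0 \<in> run k c"
        unfolding eq using zero bc(1) by blast
      then have "d \<ge> 0"
        using run_nonneg by force
      moreover obtain y where "0 = d + y" "y \<in> run k b"
        using zero[OF bc(2)] unfolding eq by blast
      then have "d \<le> 0"
        using run_nonneg[of y k b] by simp
      ultimately show "S = T"
        by (simp add: d htranslate_0)
    qed
    show "(\<lambda>T. ?E `` {T}) ` R = ?A // ?E"
    proof
      show "(\<lambda>T. ?E `` {T}) ` R \<subseteq> ?A // ?E"
        using RA by (auto intro: quotientI)
      show "?A // ?E \<subseteq> (\<lambda>T. ?E `` {T}) ` R"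
      proof
        fix X assume "X \<in> ?A // ?E"
        then obtain T where T: "T \<in> ?A" "X = ?E `` {T}"
          by (auto elim: quotientE)
        then obtain b x where bx: "heap k T" "card T = n" "b \<in> {1..n}" "ground T = (+) x ` run k b"
          unfolding towers_of_area_iff[OF assms] by blast
        let ?S = "htranslate (- x) T"
        have "ground ?S = run k b"
          by (simp add: ground_htranslate bx(4) image_image)
        then have S: "?S \<in> R"
          using bx heap_htranslate card_htranslate by (auto simp: R_def H_def)
        then have "(T, ?S) \<in> ?E"
          using T(1) RA by (auto simp: htranslate_rel_def)
        then have "X = ?E `` {?S}"
          using equiv_class_eq[OF equiv_htranslate_rel] T(2) by blast
        then show "X \<in> (\<lambda>T. ?E `` {T}) ` R"
          using S by blast
      qed
    qed
  qed
  then have "num_towers k n = card R"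
    unfolding num_towers_def by (simp add: bij_betw_same_card)
  also have "\<dots> = (\<Sum>b\<in>{1..n}. card (H b))"
    unfolding R_def
  proof (rule card_UN_disjoint)
    show "\<forall>b\<in>{1..n}. finite (H b)"
      using card_based_heaps(1)[OF assms] by (auto simp: H_def)
    show "\<forall>b\<in>{1..n}. \<forall>c\<in>{1..n}. b \<noteq> c \<longrightarrow> H b \<inter> H c = {}"
      using card_run[OF assms] by (auto simp: H_def) metis
  qed simp
  also have "\<dots> = (\<Sum>b\<in>{1..n}. (k * n - 1) choose (n - b))"
    using card_based_heaps(2)[OF assms] by (intro sum.cong) (auto simp: H_def)
  finally show ?thesis .
qed

section \<open>The sum of binomials as a hypergeometric series\<close>

text \<open>Both sides have the same ratio of consecutive terms. Lowering the lower index of the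
  binomial from \<open>n - 1 - m\<close> by one multiplies it by
  \<open>(n - 1 - m) / (c + m)\<close>; the Pochhammer quotient contributes the same factor, the
  sign of \<open>1 - n + m\<close> being cancelled by the power of -1.\<close>

lemma choose_times_pochhammer_ratio:
  fixes c :: real
  assumes "k \<ge> 1" "m < n"
  defines "c \<equiv> (real k - 1) * real n + 1"
  shows "real ((k * n - 1) choose (n - 1)) * (pochhammer (1 - real n) m / pochhammer c m * (- 1) ^ m) =
    real ((k * n - 1) choose (n - 1 - m))"
  using assms(2)
proof (induction m)
  case (Suc m)
  let ?N = "k * n - 1" and ?j = "n - 1 - Suc m"
  let ?P = "pochhammer (1 - real n) m / pochhammer c m * (- 1) ^ m"
  have j: "n - 1 - m = Suc ?j"
    using Suc.prems by simp
  have "n \<le> k * n"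
    using assms(1) by simp
  moreover from this have "?N - ?j = k * n - n + Suc m"
    using Suc.prems by linarith
  ultimately have Nj: "real (?N - ?j) = c + real m"
    by (simp add: c_def of_nat_diff algebra_simps)
  have c: "c + real m > 0"
    using assms(1) by (simp add: c_def add_nonneg_pos add_pos_nonneg)
  have "real (Suc ?j) * real (?N choose Suc ?j) = real (?N - ?j) * real (?N choose ?j)"
    using binomial_Suc_step[of ?j ?N] by (metis of_nat_mult)
  then have step: "real (?N choose ?j) = real (?N choose (n - 1 - m)) * (real n - 1 - real m) / (c + real m)"
    unfolding Nj j[symmetric] using c Suc.prems by (simp add: field_simps)
  have "real (?N choose (n - 1)) *
      (pochhammer (1 - real n) (Suc m) / pochhammer c (Suc m) * (- 1) ^ Suc m) =
      real (?N choose (n - 1)) * ?P * ((real n - 1 - real m) / (c + real m))"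
    by (simp add: pochhammer_Suc field_simps)
  also have "\<dots> = real (?N choose ?j)"
    using Suc step by simp
  finally show ?case .
qed simp

text \<open>The rising factorial of \<open>1 - n\<close> reaches the factor 0 once \<open>m\<close>
  is at least \<open>n\<close>, and that of 1 is \<open>fact m\<close>, which cancels the factorial
  of the series.\<close>

lemma gauss_2F1_terminating:
  assumes "n \<ge> 1"
  shows "gauss_2F1 1 (1 - real n) c z = (\<Sum>m<n. pochhammer (1 - real n) m / pochhammer c m * z ^ m)"
proof -
  have neg: "1 - real n = - real (n - 1)"
    using assms by simp
  have "pochhammer (1 - real n) m = 0" if "m \<ge> n" for m
    unfolding neg pochhammer_of_nat_eq_0_iff using that assms by linarith
  then have "gauss_2F1 1 (1 - real n) c z =
      (\<Sum>m<n. pochhammer 1 m * pochhammer (1 - real n) m / pochhammer c m * (z ^ m / fact m))"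
    unfolding gauss_2F1_def by (intro suminf_finite) auto
  also have "\<dots> = (\<Sum>m<n. pochhammer (1 - real n) m / pochhammer c m * z ^ m)"
    by (intro sum.cong) (auto simp: pochhammer_fact[symmetric])
  finally show ?thesis .
qed

theorem theorem1p1:
  fixes k n :: nat
  assumes "k \<ge> 1" and "n \<ge> 1"
  shows "real (num_towers k n) =
    real ((k * n - 1) choose (n - 1)) *
    gauss_2F1 1 (1 - real n) ((real k - 1) * real n + 1) (- 1)"
proof -
  have "real ((k * n - 1) choose (n - 1)) * gauss_2F1 1 (1 - real n) ((real k - 1) * real n + 1) (- 1) =
      (\<Sum>m<n. real ((k * n - 1) choose (n - 1 - m)))"
    unfolding gauss_2F1_terminating[OF assms(2)] sum_distrib_left
    using assms by (intro sum.cong refl choose_times_pochhammer_ratio) auto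
  also have "\<dots> = (\<Sum>b\<in>{1..n}. real ((k * n - 1) choose (n - b)))"
    by (rule sum.reindex_bij_witness[of _ "\<lambda>b. b - 1" Suc]) auto
  also have "\<dots> = real (num_towers k n)"
    by (simp add: num_towers_eq_sum[OF assms(1)])
  finally show ?thesis by simp
qed

end
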